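(* For a program $S$ and variables $x_i$ and $y_i$, the conditional entropy $H(y_i\mid x_i)$ of the value of $y_i$ on termination of $S$ given $x_i$ (and conditioned on all observe statements succeeding) can be computed as follows: $$H(y_i\mid x_i)\;=\;\mathsf{cwp}[\![S]\!]\Big(-\log\big[\![\,\mathsf{cwp}[\![S]\!]([\underline{x_i}=x_i\wedge\underline{y_i}=y_i],\;[\underline{x_i}=x_i])\,\big]\!][\underline{x_i}\mapsto x_i][\underline{y_i}\mapsto y_i],\;\mathbf 1\Big),$$ where $\underline{x_i},\underline{y_i}$ are ghost variables (fresh variables not occurring in $S$). Both sides are functions of the initial state $\sigma$ of $S$, the right-hand conditional expectation being evaluated in $\sigma$ as the quotient of its two components, for $\sigma$ with $\mathsf{wp}[\![S]\!](\mathbf 1)(\sigma)\neq 0$. The inner expression, after the substitutions, is an ordinary expectation that serves as post-expectation of the outer $\mathsf{cwp}$.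
   Context: Programs are given by $S::=\mathtt{skip}\mid S;S\mid x:=e\mid x\sim\mu\mid\mathtt{observe}(b)\mid\mathtt{if}\ b\ \{S\}\ \mathtt{else}\ \{S\}\mid\mathtt{for}\ i\ \mathtt{in}\ 1..n\ \{S\}$, with $n$ a constant. States are maps $\sigma:\mathbf{Vars}\to\mathbb{Q}_{\ge0}$ (ghost variables included). In state $\sigma$, an expression $e$ evaluates to $e(\sigma)\in\mathbb{Q}_{\ge0}$, a Boolean expression $b$ to a truth value, and a distribution expression $\mu$ to a (discrete) probability distribution $\mu_\sigma$ on $\mathbb{Q}_{\ge0}$. Expectations are functions $X:\mathsf{States}\to[0,\infty]$. $[b]$ is the Iverson bracket ($1$ if $b$ holds, else $0$), $\mathbf 1$ is the constant $1$, and substitution is $X[x\mapsto e](\sigma)=X(\sigma[x\mapsto e(\sigma)])$. For $X\le\mathbf 1$, $-\log(X)$ is the expectation $\sigma\mapsto-\log(X(\sigma))$, with $-\log 0=\infty$. The transformer $\mathsf{wp}[\![S]\!]$ on expectations is defined by: $\mathsf{wp}[\![\mathtt{skip}]\!](X)=X$; $\mathsf{wp}[\![x:=e]\!](X)=X[x\mapsto e]$; $\mathsf{wp}[\![x\sim\mu]\!](X)(\sigma)=\int X(\sigma[x\mapsto v])\,d\mu_\sigma(v)$; $\mathsf{wp}[\![\mathtt{observe}(b)]\!](X)=[b]\cdot X$; $\mathsf{wp}[\![S_1;S_2]\!](X)=\mathsf{wp}[\![S_1]\!](\mathsf{wp}[\![S_2]\!](X))$; $\mathsf{wp}[\![\mathtt{if}\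 b\ \{S_1\}\ \mathtt{else}\ \{S_2\}]\!](X)=[b]\cdot\mathsf{wp}[\![S_1]\!](X)+[\neg b]\cdot\mathsf{wp}[\![S_2]\!](X)$; $\mathsf{wp}[\![\mathtt{for}\ i\ \mathtt{in}\ 1..n\ \{S\}]\!](X)=\mathsf{wp}[\![i:=1]\!]\big((\mathsf{wp}[\![S;\,i:=i+1]\!])^n(X)\big)$, with the usual convention $0\cdot\infty=0$. Further, a conditional expectation is a pair $(X,Y)$ of expectations, $\mathsf{cwp}[\![S]\!](X,Y)=(\mathsf{wp}[\![S]\!](X),\mathsf{wp}[\![S]\!](Y))$, and $[\![(X,Y)]\!]=X/Y$ (pointwise) denotes its evaluation into an expectation where this is defined, i.e. where $Y\neq0$. Running $S$ from a state $\sigma$ yields a sub-probability distribution $P^S_\sigma$ over final states, runs in which an observation fails being discarded. Let $p_\sigma(v,w)=P^S_\sigma(\{\tau:\tau(x_i)=v,\tau(y_i)=w\})/P^S_\sigma(\mathsf{States})$ be the joint mass function of $(x_i,y_i)$ on termination conditioned on all observe statements succeeding, and $p_\sigma(v)=\sum_w p_\sigma(v,w)$. Then $H(y_i\mid x_i)=-\sum_{v,w}p_\sigma(v,w)\log\frac{p_\sigma(v,w)}{p_\sigma(v)}$.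
   Formalization: As written the formula fails (S: y:=y+1 gives ∞, not 0). Proved for all S with the inner program variables kept at the initial state, only the ghosts taking final values; the literal formula is proved when the law of (x,y) from each reachable final state equals that from the initial state. *)

theory Defs
  imports "HOL-Probability.Probability"
begin

typedef nnrat = "{q :: rat. 0 \<le> q}"
  by auto

setup_lifting type_definition_nnrat

instantiation nnrat :: comm_semiring_1
begin

lift_definition zero_nnrat :: nnrat is 0 by simp
lift_definition one_nnrat :: nnrat is 1 by simp
lift_definition plus_nnrat :: "nnrat \<Rightarrow> nnrat \<Rightarrow> nnrat" is "(+)" by simp
lift_definition times_nnrat :: "nnrat \<Rightarrow> nnrat \<Rightarrow> nnrat" is "(*)" by simp

instance
  by standard (transfer; simp add: algebra_simps)+

end

type_synonym 'v state = "'v \<Rightarrow> nnrat"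

(* Expressions are represented by their evaluation maps. Distributions on the countable set
   of nonnegative rationals are exactly the elements of nnrat pmf. *)
datatype 'v prog =
    Skip
  | Seq "'v prog" "'v prog"
  | Assign 'v "'v state \<Rightarrow> nnrat"
  | Sample 'v "'v state \<Rightarrow> nnrat pmf"
  | Observe "'v state \<Rightarrow> bool"
  | Cond "'v state \<Rightarrow> bool" "'v prog" "'v prog"
  | For 'v nat "'v prog"

definition indep :: "'v \<Rightarrow> ('v state \<Rightarrow> 'a) \<Rightarrow> bool" where
  "indep z f \<longleftrightarrow> (\<forall>\<sigma> v. f (\<sigma>(z := v)) = f \<sigma>)"

(* Non-occurrence in an expression is rendered semantically, as independence of the variable.
   This is implied by syntactic non-occurrence. *)
primrec fresh :: "'v \<Rightarrow> 'v prog \<Rightarrow> bool" where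
  "fresh z Skip \<longleftrightarrow> True"
| "fresh z (Seq S1 S2) \<longleftrightarrow> fresh z S1 \<and> fresh z S2"
| "fresh z (Assign x e) \<longleftrightarrow> z \<noteq> x \<and> indep z e"
| "fresh z (Sample x \<mu>) \<longleftrightarrow> z \<noteq> x \<and> indep z \<mu>"
| "fresh z (Observe b) \<longleftrightarrow> indep z b"
| "fresh z (Cond b S1 S2) \<longleftrightarrow> indep z b \<and> fresh z S1 \<and> fresh z S2"
| "fresh z (For i n S) \<longleftrightarrow> z \<noteq> i \<and> fresh z S"

(* The sub-probability distribution over final states. Failed observations yield
   return_pmf None, so their mass is lost. *)
primrec run :: "'v prog \<Rightarrow> 'v state \<Rightarrow> 'v state spmf" where
  "run Skip = return_spmf"
| "run (Seq S1 S2) = (\<lambda>\<sigma>. bind_spmf (run S1 \<sigma>) (run S2))"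
| "run (Assign x e) = (\<lambda>\<sigma>. return_spmf (\<sigma>(x := e \<sigma>)))"
| "run (Sample x \<mu>) = (\<lambda>\<sigma>. spmf_of_pmf (map_pmf (\<lambda>v. \<sigma>(x := v)) (\<mu> \<sigma>)))"
| "run (Observe b) = (\<lambda>\<sigma>. if b \<sigma> then return_spmf \<sigma> else return_pmf None)"
| "run (Cond b S1 S2) = (\<lambda>\<sigma>. if b \<sigma> then run S1 \<sigma> else run S2 \<sigma>)"
| "run (For i n S) = (\<lambda>\<sigma>.
     ((\<lambda>k \<rho>. bind_spmf (run S \<rho>) (\<lambda>\<tau>. k (\<tau>(i := \<tau> i + 1)))) ^^ n) return_spmf (\<sigma>(i := 1)))"

type_synonym 'v expectation = "'v state \<Rightarrow> ennreal"

definition iverson :: "('v state \<Rightarrow> bool) \<Rightarrow> 'v expectation" where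
  "iverson b = (\<lambda>\<sigma>. of_bool (b \<sigma>))"

definition subst :: "'v \<Rightarrow> ('v state \<Rightarrow> nnrat) \<Rightarrow> 'v expectation \<Rightarrow> 'v expectation" where
  "subst x e X = (\<lambda>\<sigma>. X (\<sigma>(x := e \<sigma>)))"

(* Meant for X \<le> 1. The base of the logarithm is a parameter. *)
definition neg_log :: "real \<Rightarrow> 'v expectation \<Rightarrow> 'v expectation" where
  "neg_log b X = (\<lambda>\<sigma>. if X \<sigma> = 0 then \<infinity> else ennreal (- log b (enn2real (X \<sigma>))))"

primrec wp :: "'v prog \<Rightarrow> 'v expectation \<Rightarrow> 'v expectation" where
  "wp Skip = (\<lambda>X. X)"
| "wp (Seq S1 S2) = (\<lambda>X. wp S1 (wp S2 X))"
| "wp (Assign x e) = subst x e"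
| "wp (Sample x \<mu>) = (\<lambda>X \<sigma>. \<integral>\<^sup>+ v. X (\<sigma>(x := v)) \<partial>measure_pmf (\<mu> \<sigma>))"
| "wp (Observe b) = (\<lambda>X \<sigma>. iverson b \<sigma> * X \<sigma>)"
| "wp (Cond b S1 S2) =
     (\<lambda>X \<sigma>. iverson b \<sigma> * wp S1 X \<sigma> + iverson (\<lambda>\<rho>. \<not> b \<rho>) \<sigma> * wp S2 X \<sigma>)"
| "wp (For i n S) =
     (\<lambda>X. subst i (\<lambda>_. 1) (((\<lambda>Y. wp S (subst i (\<lambda>\<sigma>. \<sigma> i + 1) Y)) ^^ n) X))"

type_synonym 'v cond_expectation = "'v expectation \<times> 'v expectation"

definition cwp :: "'v prog \<Rightarrow> 'v cond_expectation \<Rightarrow> 'v cond_expectation" where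
  "cwp S = map_prod (wp S) (wp S)"

(* Only meaningful where the second component is nonzero. *)
definition ceval :: "'v cond_expectation \<Rightarrow> 'v expectation" where
  "ceval XY = (\<lambda>\<sigma>. fst XY \<sigma> / snd XY \<sigma>)"

definition joint_mass :: "'v prog \<Rightarrow> 'v \<Rightarrow> 'v \<Rightarrow> 'v state \<Rightarrow> nnrat \<Rightarrow> nnrat \<Rightarrow> real" where
  "joint_mass S x y \<sigma> v w =
     measure (measure_spmf (run S \<sigma>)) {\<tau>. \<tau> x = v \<and> \<tau> y = w} /
     measure (measure_spmf (run S \<sigma>)) UNIV"

definition marginal_mass :: "'v prog \<Rightarrow> 'v \<Rightarrow> 'v \<Rightarrow> 'v state \<Rightarrow> nnrat \<Rightarrow> real" where
  "marginal_mass S x y \<sigma> v = (\<Sum>\<^sub>\<infinity>w. joint_mass S x y \<sigma> v w)"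

(* H(y | x). All summands are nonnegative since joint \<le> marginal, hence summation in
   ennreal loses nothing and assigns the value \<infinity> to a divergent series. Summands with
   joint mass 0 vanish. *)
definition cond_entropy :: "real \<Rightarrow> 'v prog \<Rightarrow> 'v \<Rightarrow> 'v \<Rightarrow> 'v state \<Rightarrow> ennreal" where
  "cond_entropy b S y x \<sigma> =
     (\<Sum>\<^sub>\<infinity>(v, w). ennreal (- (joint_mass S x y \<sigma> v w *
        log b (joint_mass S x y \<sigma> v w / marginal_mass S x y \<sigma> v))))"

(* The surprisal - log [[cwp S ([gx = x \<and> gy = y], [gx = x])]], before the ghosts are replaced.
   In a state \<sigma> with ghost values v and w it is - log of the probability, over the runs of S
   started in \<sigma>, of y = w given x = v. *)
definition surprisal ::
  "real \<Rightarrow> 'v prog \<Rightarrow> 'v \<Rightarrow> 'v \<Rightarrow> 'v \<Rightarrow> 'v \<Rightarrow> 'v expectation" where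
  "surprisal b S gx x gy y = neg_log b (ceval (cwp S
     (iverson (\<lambda>\<sigma>. \<sigma> gx = \<sigma> x \<and> \<sigma> gy = \<sigma> y), iverson (\<lambda>\<sigma>. \<sigma> gx = \<sigma> x))))"

(* In  cwp S (surprisal[gx \<mapsto> x][gy \<mapsto> y], 1)  the ghosts must take the final values of x and y,
   whereas the program variables the surprisal depends on must keep their values in the
   initial state \<sigma>. Replacing the whole state by the final one makes the inner cwp
   restart S where it ended, which computes the entropy only if the law of (x, y) is the same
   from there. The following lemma shows this for  y := y + 1,  where no quotient is
   undefined: the entropy is 0, the unanchored expression is \<infinity>. *)
lemma unanchored_substitution_fails:
  fixes x y gx gy :: 'v and \<sigma> :: "'v state" and b :: real
  assumes distinct: "distinct [x, y, gx, gy]"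
  defines "S \<equiv> Assign y (\<lambda>\<sigma>. \<sigma> y + 1)"
  shows "fresh gx S" "fresh gy S" "wp S (\<lambda>_. 1) \<sigma> = 1"
    and "subst gy (\<lambda>\<sigma>. \<sigma> y) (subst gx (\<lambda>\<sigma>. \<sigma> x) (wp S (iverson (\<lambda>\<sigma>. \<sigma> gx = \<sigma> x)))) = (\<lambda>_. 1)"
    and "cond_entropy b S y x \<sigma> = 0"
    and "ceval (cwp S (subst gy (\<lambda>\<sigma>. \<sigma> y) (subst gx (\<lambda>\<sigma>. \<sigma> x)
           (surprisal b S gx x gy y)), \<lambda>_. 1)) \<sigma> = \<infinity>"
proof -
  have neq: "v \<noteq> v + 1" for v :: nnrat
    by transfer simp
  have jm: "joint_mass S x y \<sigma> v w = (if v = \<sigma> x \<and> w = \<sigma> y + 1 then 1 else 0)" for v w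
    using distinct by (auto simp: joint_mass_def S_def measure_return indicator_def
      measure_spmf_return_spmf)
  have mm: "marginal_mass S x y \<sigma> v = (if v = \<sigma> x then 1 else 0)" for v
  proof -
    have "marginal_mass S x y \<sigma> v =
        (\<Sum>\<^sub>\<infinity>w\<in>{\<sigma> y + 1}. if v = \<sigma> x \<and> w = \<sigma> y + 1 then 1 else (0 :: real))"
      unfolding marginal_mass_def jm by (rule infsum_cong_neutral) auto
    then show ?thesis by simp
  qed
  show "cond_entropy b S y x \<sigma> = 0"
    unfolding cond_entropy_def by (rule infsum_0) (auto simp: jm mm)
  show "fresh gx S" "fresh gy S" "wp S (\<lambda>_. 1) \<sigma> = 1"
    using distinct by (auto simp: S_def indep_def subst_def)
  show "subst gy (\<lambda>\<sigma>. \<sigma> y) (subst gx (\<lambda>\<sigma>. \<sigma> x) (wp S (iverson (\<lambda>\<sigma>. \<sigma> gx = \<sigma> x)))) = (\<lambda>_. 1)"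
    using distinct by (auto simp: S_def subst_def iverson_def)
  show "ceval (cwp S (subst gy (\<lambda>\<sigma>. \<sigma> y) (subst gx (\<lambda>\<sigma>. \<sigma> x)
      (surprisal b S gx x gy y)), \<lambda>_. 1)) \<sigma> = \<infinity>"
    using distinct neq by (auto simp: S_def surprisal_def neg_log_def ceval_def cwp_def
      subst_def iverson_def divide_ennreal_def)
qed

end

theory Submission
  imports Defs
begin

text \<open>
  The transformer \<open>wp S\<close> integrates its post-expectation against the law of \<open>run S\<close>, and a run
  from a state with altered values of fresh variables is the original run with these values
  altered in the final states. Hence the surprisal at a state with ghost values v and w is
  - log (q(v, w) / q(v)), where q is the law of the final values of x and y from that state, and
  integrating it against q gives the weighted sum that defines the entropy. The conditioning on
  the observations cancels inside the logarithm and leaves one factor outside. For the unanchored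
  substitution the surprisal is taken from the final state, and the assumption on the laws makes
  the two integrands agree almost everywhere.
\<close>

lemma nn_integral_bind_spmf:
  "(\<integral>\<^sup>+ x. f x \<partial>measure_spmf (bind_spmf p q)) = (\<integral>\<^sup>+ x. \<integral>\<^sup>+ y. f y \<partial>measure_spmf (q x) \<partial>measure_spmf p)"
  unfolding measure_spmf_bind
  by (subst nn_integral_bind[where B = "count_space UNIV"])
    (auto simp: space_subprob_algebra measure_spmf.subprob_space_axioms
      intro!: subprob_space_measure_spmf)

lemma nn_integral_return_spmf: "(\<integral>\<^sup>+ x. f x \<partial>measure_spmf (return_spmf a)) = f a"
  by (simp add: measure_spmf_return_spmf nn_integral_return)

lemma wp_eq_nn_integral: "wp S X \<sigma> = (\<integral>\<^sup>+ \<tau>. X \<tau> \<partial>measure_spmf (run S \<sigma>))"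
proof (induction S arbitrary: X \<sigma>)
  case (For i n S)
  \<comment> \<open>The start state \<open>\<rho>\<close> is arbitrary because each iteration hands
    the next one a different state; the initialisation of \<open>i\<close> is added only
    afterwards.\<close>
  have "((\<lambda>Y. wp S (subst i (\<lambda>\<sigma>. \<sigma> i + 1) Y)) ^^ n) X \<rho> =
      (\<integral>\<^sup>+ \<tau>. X \<tau> \<partial>measure_spmf
        (((\<lambda>k \<rho>. bind_spmf (run S \<rho>) (\<lambda>\<tau>. k (\<tau>(i := \<tau> i + 1)))) ^^ n) return_spmf \<rho>))" for \<rho>
    by (induction n arbitrary: \<rho>) (simp_all add: For nn_integral_return_spmf nn_integral_bind_spmf subst_def)
  then show ?case
    by (simp add: subst_def)
next
  case (Seq S1 S2)
  have "wp S2 X = (\<lambda>\<rho>. \<integral>\<^sup>+ \<tau>. X \<tau> \<partial>measure_spmf (run S2 \<rho>))"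
    by (intro ext Seq.IH)
  then show ?case
    by (simp add: Seq.IH(1) nn_integral_bind_spmf)
qed (auto simp: nn_integral_bind_spmf nn_integral_return_spmf subst_def iverson_def)

text \<open>No expression of \<open>S\<close> depends on \<open>z\<close> and no statement writes
  it, so overwriting \<open>z\<close> commutes with every step of the run.\<close>

lemma run_fun_upd_fresh:
  "fresh z S \<Longrightarrow> run S (\<sigma>(z := v)) = map_spmf (\<lambda>\<tau>. \<tau>(z := v)) (run S \<sigma>)"
proof (induction S arbitrary: \<sigma>)
  case (Seq S1 S2)
  then show ?case
    by (simp add: map_spmf_bind_spmf bind_map_spmf o_def)
next
  case (Sample x \<mu>)
  then have "\<mu> (\<sigma>(z := v)) = \<mu> \<sigma>" "fun_upd (\<sigma>(z := v)) x = (\<lambda>u. \<sigma>(x := u, z := v))"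
    by (auto simp: indep_def fun_upd_twist)
  then show ?case
    unfolding run.simps map_spmf_of_pmf map_pmf_comp by (simp only:)
next
  case (For i n S)
  have "((\<lambda>k \<rho>. bind_spmf (run S \<rho>) (\<lambda>\<tau>. k (\<tau>(i := \<tau> i + 1)))) ^^ n) return_spmf (\<rho>(z := v)) =
      map_spmf (\<lambda>\<tau>. \<tau>(z := v))
        (((\<lambda>k \<rho>. bind_spmf (run S \<rho>) (\<lambda>\<tau>. k (\<tau>(i := \<tau> i + 1)))) ^^ n) return_spmf \<rho>)" for \<rho>
  proof (induction n arbitrary: \<rho>)
    case (Suc n)
    \<comment> \<open>The increment neither reads nor writes \<open>z\<close>, as the loop counter
      differs from it.\<close>
    have "\<tau>(z := v, i := (\<tau>(z := v)) i + 1) = \<tau>(i := \<tau> i + 1, z := v)" for \<tau>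
      using For.prems by (auto simp: fun_upd_twist)
    moreover have "run S (\<rho>(z := v)) = map_spmf (\<lambda>\<tau>. \<tau>(z := v)) (run S \<rho>)"
      using For.prems by (intro For.IH) simp
    ultimately show ?case
      by (simp only: funpow.simps comp_def map_spmf_bind_spmf bind_map_spmf Suc.IH)
  qed simp
  moreover have "\<sigma>(z := v, i := 1) = \<sigma>(i := 1, z := v)"
    using For.prems by (simp add: fun_upd_twist)
  ultimately show ?case
    by (simp only: run.simps)
qed (auto simp: indep_def fun_upd_twist)

instance nnrat :: countable
  by (rule countable_classI[where f = "\<lambda>q. to_nat (Rep_nnrat q)"]) (simp add: Rep_nnrat_inject)

text \<open>Both sides are suprema of finite partial sums: for the integral, the finite sets
  \<open>A n\<close> exhaust the countable type and monotone convergence applies.\<close>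

lemma infsum_ennreal_eq_nn_integral_count_space:
  fixes f :: "'a :: countable \<Rightarrow> ennreal"
  shows "(\<Sum>\<^sub>\<infinity>x. f x) = (\<integral>\<^sup>+ x. f x \<partial>count_space UNIV)"
proof (rule antisym)
  have "sum f F \<le> (\<integral>\<^sup>+ x. f x \<partial>count_space UNIV)" if "finite F" for F
  proof -
    have "sum f F = (\<integral>\<^sup>+ x. f x * indicator F x \<partial>count_space UNIV)"
      using that by (simp add: nn_integral_count_space_finite flip: nn_integral_count_space_indicator)
    also have "\<dots> \<le> (\<integral>\<^sup>+ x. f x \<partial>count_space UNIV)"
      by (intro nn_integral_mono) (auto simp: indicator_def)
    finally show ?thesis .
  qed
  then show "(\<Sum>\<^sub>\<infinity>x. f x) \<le> (\<integral>\<^sup>+ x. f x \<partial>count_space UNIV)"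
    by (subst nonneg_infsum_complete) (auto intro!: SUP_least)
next
  define A where "A n = {x :: 'a. to_nat x < n}" for n
  have fin: "finite (A n)" for n
    unfolding A_def by (rule finite_imageD[of to_nat]) (auto intro: finite_subset[of _ "{..<n}"] inj_onI)
  have "incseq (\<lambda>n x. f x * indicator (A n) x)"
    by (auto simp: incseq_def le_fun_def A_def indicator_def)
  moreover have "(SUP n. f x * indicator (A n) x) = f x" for x
  proof (rule antisym)
    show "f x \<le> (SUP n. f x * indicator (A n) x)"
      by (rule SUP_upper2[of "Suc (to_nat x)"]) (auto simp: A_def)
  qed (auto intro!: SUP_least simp: indicator_def)
  ultimately have "(\<integral>\<^sup>+ x. f x \<partial>count_space UNIV) =
      (SUP n. \<integral>\<^sup>+ x. f x * indicator (A n) x \<partial>count_space UNIV)"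
    by (subst nn_integral_monotone_convergence_SUP[symmetric]) auto
  also have "\<dots> = (SUP n. sum f (A n))"
    using fin by (simp add: nn_integral_count_space_finite flip: nn_integral_count_space_indicator)
  also have "\<dots> \<le> (\<Sum>\<^sub>\<infinity>x. f x)"
    by (subst nonneg_infsum_complete) (auto intro!: SUP_mono intro: fin)
  finally show "(\<integral>\<^sup>+ x. f x \<partial>count_space UNIV) \<le> (\<Sum>\<^sub>\<infinity>x. f x)" .
qed

lemma infsum_spmf_Pair:
  "(\<Sum>\<^sub>\<infinity>w. spmf q (v, w)) = measure (measure_spmf q) (Pair v ` UNIV)"
proof -
  have eq: "(\<integral>\<^sup>+ w. spmf q (v, w) \<partial>count_space UNIV) = emeasure (measure_spmf q) (Pair v ` UNIV)"
    unfolding nn_integral_spmf[symmetric]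
    by (rule nn_integral_bij_count_space) (auto simp: bij_betw_def inj_on_def)
  \<comment> \<open>A real \<open>infsum\<close> defaults to 0 without summability; here the finite
    mass of the fibre over \<open>v\<close> bounds the sum.\<close>
  have "Infinite_Set_Sum.abs_summable_on (\<lambda>w. spmf q (v, w)) UNIV"
    unfolding abs_summable_on_def integrable_iff_bounded
    using eq by (simp add: measure_spmf.emeasure_eq_measure)
  then have "(\<Sum>\<^sub>\<infinity>w. spmf q (v, w)) = (\<Sum>\<^sub>aw. spmf q (v, w))"
    by (simp add: infsetsum_infsum abs_summable_equivalent)
  also have "\<dots> = enn2real (\<integral>\<^sup>+ w. spmf q (v, w) \<partial>count_space UNIV)"
    by (rule infsetsum_conv_nn_integral) (auto simp: eq measure_spmf.emeasure_eq_measure)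
  finally show ?thesis
    by (simp add: eq measure_spmf.emeasure_eq_measure)
qed

text \<open>The case split keeps the value \<open>\<infinity>\<close> at null pairs, as the junk value of log at 0 would be finite.\<close>

definition pair_surprisal :: "real \<Rightarrow> ('a \<times> 'b) spmf \<Rightarrow> 'a \<times> 'b \<Rightarrow> ennreal" where
  "pair_surprisal b q r = (if spmf q r = 0 then \<infinity>
     else ennreal (- log b (spmf q r / measure (measure_spmf q) (Pair (fst r) ` UNIV))))"

text \<open>Used twice below: a pair of positive mass has a fibre of positive mass, and the
  logarithm of the quotient is at most 0.\<close>

lemma spmf_le_measure_Pair: "spmf q (v, w) \<le> measure (measure_spmf q) (Pair v ` UNIV)"
  unfolding spmf_conv_measure_spmf by (rule measure_spmf.finite_measure_mono) auto

text \<open>Moving the ghost updates to the final states turns the tests on the ghosts into tests of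
  the final \<open>x\<close> and \<open>y\<close> against the constants \<open>v\<close> and
  \<open>w\<close>. Numerator and denominator are then the masses of a point and of its
  fibre.\<close>

lemma surprisal_ghosts:
  assumes "fresh gx S" "fresh gy S" "gx \<noteq> gy" "gx \<notin> {x, y}" "gy \<notin> {x, y}"
  shows "surprisal b S gx x gy y (\<sigma>(gx := v, gy := w)) =
    pair_surprisal b (map_spmf (\<lambda>\<rho>. (\<rho> x, \<rho> y)) (run S \<sigma>)) (v, w)"
proof -
  let ?q = "map_spmf (\<lambda>\<rho>. (\<rho> x, \<rho> y)) (run S \<sigma>)"
  let ?m = "measure (measure_spmf ?q) (Pair v ` UNIV)"
  have wp: "wp S X (\<sigma>(gx := v, gy := w)) = (\<integral>\<^sup>+ \<tau>. X (\<tau>(gx := v, gy := w)) \<partial>measure_spmf (run S \<sigma>))" for X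
    using assms by (simp add: wp_eq_nn_integral run_fun_upd_fresh o_def)
  have joint: "wp S (iverson (\<lambda>\<sigma>. \<sigma> gx = \<sigma> x \<and> \<sigma> gy = \<sigma> y)) (\<sigma>(gx := v, gy := w)) = ennreal (spmf ?q (v, w))"
  proof -
    have "wp S (iverson (\<lambda>\<sigma>. \<sigma> gx = \<sigma> x \<and> \<sigma> gy = \<sigma> y)) (\<sigma>(gx := v, gy := w)) =
        (\<integral>\<^sup>+ \<tau>. indicator ((\<lambda>\<rho>. (\<rho> x, \<rho> y)) -` {(v, w)}) \<tau> \<partial>measure_spmf (run S \<sigma>))"
      unfolding wp iverson_def indicator_def
      using assms by (intro nn_integral_cong arg_cong[where f = of_bool]) auto
    then show ?thesis
      by (simp add: ennreal_spmf_map)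
  qed
  have marginal: "wp S (iverson (\<lambda>\<sigma>. \<sigma> gx = \<sigma> x)) (\<sigma>(gx := v, gy := w)) = ennreal ?m"
  proof -
    have "wp S (iverson (\<lambda>\<sigma>. \<sigma> gx = \<sigma> x)) (\<sigma>(gx := v, gy := w)) =
        (\<integral>\<^sup>+ \<tau>. indicator ((\<lambda>\<rho>. (\<rho> x, \<rho> y)) -` Pair v ` UNIV) \<tau> \<partial>measure_spmf (run S \<sigma>))"
      unfolding wp iverson_def indicator_def
      using assms by (intro nn_integral_cong arg_cong[where f = of_bool]) auto
    then show ?thesis
      by (simp add: emeasure_map_spmf flip: measure_spmf.emeasure_eq_measure)
  qed
  show ?thesis
  proof (cases "spmf ?q (v, w) = 0")
    \<comment> \<open>A zero numerator makes the quotient 0 even over a zero denominator, so both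
      sides are \<infinity>.\<close>
    case True
    then show ?thesis
      by (simp add: surprisal_def neg_log_def ceval_def cwp_def joint pair_surprisal_def)
  next
    case False
    then have pos: "0 < spmf ?q (v, w)"
      by (simp add: less_le)
    then have "0 < ?m"
      using spmf_le_measure_Pair by (rule less_le_trans)
    with pos show ?thesis
      by (simp add: surprisal_def neg_log_def ceval_def cwp_def joint marginal pair_surprisal_def
          divide_ennreal)
  qed
qed

lemma cond_entropy_eq_nn_integral:
  fixes x y :: 'v
  assumes "b > 1" "weight_spmf (run S \<sigma>) \<noteq> 0"
  defines "q \<equiv> map_spmf (\<lambda>\<rho>. (\<rho> x, \<rho> y)) (run S \<sigma>)"
  shows "cond_entropy b S y x \<sigma> =
    (\<integral>\<^sup>+ r. pair_surprisal b q r \<partial>measure_spmf q) / weight_spmf (run S \<sigma>)"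
proof -
  let ?M = "weight_spmf (run S \<sigma>)"
  let ?m = "\<lambda>v. measure (measure_spmf q) (Pair v ` UNIV)"
  have M: "0 < ?M"
    using assms(2) by (simp add: less_le)
  have joint: "joint_mass S x y \<sigma> v w = spmf q (v, w) / ?M" for v w
    unfolding joint_mass_def q_def spmf_map weight_spmf_def space_measure_spmf
    by (intro arg_cong2[where f = "(/)"] arg_cong2[where f = measure]) auto
  have marginal: "marginal_mass S x y \<sigma> v = ?m v / ?M" for v
    unfolding marginal_mass_def joint infsum_spmf_Pair[symmetric] divide_inverse
    by (rule infsum_cmult_left')
  have "ennreal (- (joint_mass S x y \<sigma> v w * log b (joint_mass S x y \<sigma> v w / marginal_mass S x y \<sigma> v))) =
      ennreal (spmf q (v, w)) * pair_surprisal b q (v, w) / ?M" for v w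
  proof (cases "spmf q (v, w) = 0")
    \<comment> \<open>The infinite surprisal is cancelled by the weight, since 0 * \<infinity> =
      0.\<close>
    case True
    then show ?thesis
      by (simp add: joint)
  next
    case False
    then have pos: "0 < spmf q (v, w)"
      by (simp add: less_le)
    then have m: "0 < ?m v"
      using spmf_le_measure_Pair by (rule less_le_trans)
    \<comment> \<open>As \<open>ennreal\<close> truncates negative reals to 0, the sign is needed to
      split the product; it relies on \<open>b > 1\<close>.\<close>
    have "log b (spmf q (v, w) / ?m v) \<le> 0"
      using assms(1) pos m spmf_le_measure_Pair[of q v w] by simp
    moreover have "joint_mass S x y \<sigma> v w / marginal_mass S x y \<sigma> v = spmf q (v, w) / ?m v"
      using M by (simp add: joint marginal)
    ultimately show ?thesis
      using M pos by (simp add: joint pair_surprisal_def divide_ennreal mult_nonneg_nonpos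
          flip: ennreal_mult)
  qed
  then have "cond_entropy b S y x \<sigma> =
      (\<Sum>\<^sub>\<infinity>r. ennreal (spmf q r) * pair_surprisal b q r / ?M)"
    by (simp add: cond_entropy_def case_prod_unfold)
  then show ?thesis
    by (simp add: infsum_ennreal_eq_nn_integral_count_space nn_integral_divide nn_integral_measure_spmf)
qed

theorem proposition2:
  fixes S :: "'v prog" and x y gx gy :: 'v and \<sigma> :: "'v state" and b :: real
  assumes "b > 1"
    and "fresh gx S" and "fresh gy S"
    and "gx \<noteq> gy" and "gx \<notin> {x, y}" and "gy \<notin> {x, y}"
    and "wp S (\<lambda>_. 1) \<sigma> \<noteq> 0"
  shows "cond_entropy b S y x \<sigma> =
           ceval (cwp S (\<lambda>\<tau>. surprisal b S gx x gy y (\<sigma>(gx := \<tau> x, gy := \<tau> y)), \<lambda>_. 1)) \<sigma>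
         \<and>
         ((\<forall>\<tau> \<in> set_spmf (run S \<sigma>).
             map_spmf (\<lambda>\<rho>. (\<rho> x, \<rho> y)) (run S \<tau>) = map_spmf (\<lambda>\<rho>. (\<rho> x, \<rho> y)) (run S \<sigma>)) \<longrightarrow>
          cond_entropy b S y x \<sigma> =
           ceval (cwp S (subst gy (\<lambda>\<rho>. \<rho> y) (subst gx (\<lambda>\<rho>. \<rho> x) (surprisal b S gx x gy y)),
             \<lambda>_. 1)) \<sigma>)"
proof (intro conjI impI)
  let ?law = "\<lambda>\<tau>. map_spmf (\<lambda>\<rho>. (\<rho> x, \<rho> y)) (run S \<tau>)"
  note ghosts = surprisal_ghosts[OF assms(2-6)]
  have weight: "wp S (\<lambda>_. 1) \<sigma> = ennreal (weight_spmf (run S \<sigma>))"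
    by (simp add: wp_eq_nn_integral weight_spmf_def measure_spmf.emeasure_eq_measure)
  have entropy: "cond_entropy b S y x \<sigma> =
      (\<integral>\<^sup>+ \<tau>. pair_surprisal b (?law \<sigma>) (\<tau> x, \<tau> y) \<partial>measure_spmf (run S \<sigma>)) / wp S (\<lambda>_. 1) \<sigma>"
    using cond_entropy_eq_nn_integral[of b S \<sigma> y x] assms(1,7) by (simp add: weight o_def)
  show "cond_entropy b S y x \<sigma> =
      ceval (cwp S (\<lambda>\<tau>. surprisal b S gx x gy y (\<sigma>(gx := \<tau> x, gy := \<tau> y)), \<lambda>_. 1)) \<sigma>"
    unfolding entropy ghosts by (simp add: ceval_def cwp_def wp_eq_nn_integral)
  assume same_law: "\<forall>\<tau> \<in> set_spmf (run S \<sigma>). ?law \<tau> = ?law \<sigma>"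
  \<comment> \<open>The update of \<open>gy\<close> happens first; since \<open>gy\<close> differs
    from \<open>x\<close>, the substitution for \<open>gx\<close> still reads the value of
    \<open>x\<close> in \<open>\<tau>\<close>, and the two updates commute.\<close>
  have "subst gy (\<lambda>\<rho>. \<rho> y) (subst gx (\<lambda>\<rho>. \<rho> x) (surprisal b S gx x gy y)) \<tau> =
      pair_surprisal b (?law \<tau>) (\<tau> x, \<tau> y)" for \<tau>
    using assms(4-6) ghosts[where \<sigma> = \<tau> and v = "\<tau> x" and w = "\<tau> y"] by (auto simp: subst_def fun_upd_twist)
  then have "wp S (subst gy (\<lambda>\<rho>. \<rho> y) (subst gx (\<lambda>\<rho>. \<rho> x) (surprisal b S gx x gy y))) \<sigma> =
      (\<integral>\<^sup>+ \<tau>. pair_surprisal b (?law \<sigma>) (\<tau> x, \<tau> y) \<partial>measure_spmf (run S \<sigma>))"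
    \<comment> \<open>The laws agree only for \<open>\<tau>\<close> in the support of the run, hence
      almost everywhere.\<close>
    unfolding wp_eq_nn_integral using same_law by (intro nn_integral_cong_AE) simp
  then show "cond_entropy b S y x \<sigma> =
      ceval (cwp S (subst gy (\<lambda>\<rho>. \<rho> y) (subst gx (\<lambda>\<rho>. \<rho> x) (surprisal b S gx x gy y)), \<lambda>_. 1)) \<sigma>"
    unfolding entropy by (simp add: ceval_def cwp_def)
qed

end
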